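(* Let $1<d<n$ be integers with $n\ge 3$, and let $V$ be an $n$-dimensional real or complex Hilbert space. The only $\tau_d$-saturated subsets of $\mathbb{P}V$ are singletons and $\mathbb{P}V$ itself.
   Context: For a finite-dimensional real or complex Hilbert space $V$, $\mathbb{G}(r,V)$ denotes the Grassmannian of $r$-dimensional (linear) subspaces of $V$ and $\mathbb{P}V:=\mathbb{G}(1,V)$ is the projective space of lines (1-dimensional subspaces) in $V$. For a subspace $\pi\le V$, $P_\pi$ is the orthogonal projection of $V$ onto $\pi$. For $1\le d\le \dim V$ define a ternary relation $\tau_d$ on $\mathbb{G}(r,V)$ by: $\tau_d(\zeta,\zeta'\mid\zeta'')$ holds if and only if there is a $d$-dimensional subspace $\pi\le V$ with $\pi\supseteq\zeta$ and $\zeta''=P_\pi\zeta'$. A subset $S\subseteq\mathbb{G}(r,V)$ is $\tau_d$-saturated if for all $\zeta,\zeta'\in S$ and all $\zeta''\in\mathbb{G}(r,V)$, $\tau_d(\zeta,\zeta'\mid\zeta'')$ implies $\zeta''\in S$. Here the relevant case is $r=1$. *)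

theory Defs
  imports "HOL-Analysis.Analysis"
begin

text \<open>Vector spaces are whole types, given by their scalar multiplication \<open>scl\<close> as in the
  locale \<^locale>\<open>vector_space\<close>, so that the definitions below serve both scalar fields. Real inner
  product spaces are those of class \<^class>\<open>real_inner\<close>; in finite dimension completeness
  is automatic.\<close>

locale complex_inner_product_space = vector_space scl
  for scl :: "complex \<Rightarrow> 'v \<Rightarrow> 'v::ab_group_add" +
  fixes ip :: "'v \<Rightarrow> 'v \<Rightarrow> complex"
  assumes ip_add_left: "ip (x + y) z = ip x z + ip y z"
    and ip_scale_left: "ip (scl c x) y = c * ip x y"
    and ip_commute: "ip y x = cnj (ip x y)"
    and ip_pos: "x \<noteq> 0 \<Longrightarrow> 0 < Re (ip x x)"

definition grassmannian :: "('k::field \<Rightarrow> 'v::ab_group_add \<Rightarrow> 'v) \<Rightarrow> nat \<Rightarrow> 'v set set" where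
  "grassmannian scl r = {U. module.subspace scl U \<and> vector_space.dim scl U = r}"

definition projective_space :: "('k::field \<Rightarrow> 'v::ab_group_add \<Rightarrow> 'v) \<Rightarrow> 'v set set" where
  "projective_space scl = grassmannian scl 1"

definition orth_proj :: "('v \<Rightarrow> 'v \<Rightarrow> 'k::field) \<Rightarrow> 'v::ab_group_add set \<Rightarrow> 'v \<Rightarrow> 'v" where
  "orth_proj ip U v = (THE w. w \<in> U \<and> (\<forall>u\<in>U. ip (v - w) u = 0))"

definition tau :: "('k::field \<Rightarrow> 'v::ab_group_add \<Rightarrow> 'v) \<Rightarrow> ('v \<Rightarrow> 'v \<Rightarrow> 'k) \<Rightarrow> nat \<Rightarrow>
    'v set \<Rightarrow> 'v set \<Rightarrow> 'v set \<Rightarrow> bool" where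
  "tau scl ip d \<zeta> \<zeta>' \<zeta>'' \<longleftrightarrow>
     (\<exists>U \<in> grassmannian scl d. \<zeta> \<subseteq> U \<and> \<zeta>'' = orth_proj ip U ` \<zeta>')"

text \<open>The projection of \<open>\<zeta>'\<close> may have dimension smaller than \<open>r\<close>; such \<open>\<zeta>''\<close> impose no condition,
  as the relation lives on the Grassmannian.\<close>

definition tau_saturated :: "('k::field \<Rightarrow> 'v::ab_group_add \<Rightarrow> 'v) \<Rightarrow> ('v \<Rightarrow> 'v \<Rightarrow> 'k) \<Rightarrow> nat \<Rightarrow> nat \<Rightarrow>
    'v set set \<Rightarrow> bool" where
  "tau_saturated scl ip r d S \<longleftrightarrow> S \<subseteq> grassmannian scl r \<and>
     (\<forall>\<zeta>\<in>S. \<forall>\<zeta>'\<in>S. \<forall>\<zeta>''\<in>grassmannian scl r. tau scl ip d \<zeta> \<zeta>' \<zeta>'' \<longrightarrow> \<zeta>'' \<in> S)"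

end

theory Submission
  imports Defs "HOL-Real_Asymp.Real_Asymp"
begin

text \<open>Let \<open>K\<close> be the set of nonzero vectors spanning lines of a saturated set \<open>S\<close>. Since \<open>1 < d < n\<close>,
  saturation says exactly this much about \<open>K\<close>: if \<open>x\<close> and \<open>y\<close> lie in \<open>K\<close>, then so does every nonzero
  orthogonal projection of \<open>y\<close> to a plane or line containing \<open>x\<close>. For fixed \<open>x \<in> K\<close> consider
  the \<open>z \<bottom> x\<close> with \<open>x + z \<in> K\<close>; with \<open>z\<close>, this slice contains the projections of \<open>z\<close> to all lines
  of the orthogonal complement of \<open>x\<close>. Rotating \<open>z\<close> by an angle \<open>t\<close> in \<open>k\<close> equal steps multiplies its length
  by \<open>cos (t / k) ^ k\<close>, which tends to 1, so the slice contains the open ball of radius \<open>|z|\<close>; over the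
  complex numbers, multiplication by a phase is a rotation to an orthogonal vector and back. Hence \<open>S\<close>
  contains, with two non-orthogonal lines, the open ball about each whose radius is the angle between them.
  Adding angles makes these balls grow up to a right angle, and the remaining lines, orthogonal to \<open>x\<close>,
  are reached from another point.\<close>

text \<open>Each factor is 1 - O(1 / k^2), so \<open>k\<close> of them lose only O(1 / k) in
  total.\<close>

lemma cos_div_power_tendsto: "(\<lambda>k. cos (t / real k) ^ k) \<longlonglongrightarrow> 1"
proof -
  consider "t > 0" | "t < 0" | "t = 0" by linarith
  then show ?thesis by cases (real_asymp | simp)+
qed

section \<open>Inner products over either scalar field\<close>

text \<open>Covers both scalar fields: \<open>cj\<close> is the identity on the reals and conjugation on the complex
  numbers.\<close>

locale hermitian_space = vector_space scl
  for scl :: "'k::real_normed_field \<Rightarrow> 'v::ab_group_add \<Rightarrow> 'v" +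
  fixes cj :: "'k \<Rightarrow> 'k" and ip :: "'v \<Rightarrow> 'v \<Rightarrow> 'k"
  assumes cj_add: "cj (a + b) = cj a + cj b"
    and cj_mult: "cj (a * b) = cj a * cj b"
    and cj_of_real [simp]: "cj (of_real r) = of_real r"
    and mult_cj: "a * cj a = of_real ((norm a)\<^sup>2)"
    and ip_add_left: "ip (x + y) z = ip x z + ip y z"
    and ip_scale_left: "ip (scl c x) y = c * ip x y"
    and ip_commute: "ip y x = cj (ip x y)"
    and ip_self_norm: "ip x x = of_real (norm (ip x x))"
    and ip_self_eq_0D: "ip x x = 0 \<Longrightarrow> x = 0"
begin

text \<open>By \<open>ip_self_norm\<close> the scalar \<open>ip x x\<close> is real and nonnegative;
  \<open>norm\<close> extracts it as a real.\<close>

definition sqnorm :: "'v \<Rightarrow> real" where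
  "sqnorm x = norm (ip x x)"

lemma ip_self: "ip x x = of_real (sqnorm x)"
  unfolding sqnorm_def by (rule ip_self_norm)

lemma sqnorm_eqI: "ip x x = of_real r \<Longrightarrow> 0 \<le> r \<Longrightarrow> sqnorm x = r"
  by (simp add: sqnorm_def)

lemma sqnorm_nonneg [simp]: "0 \<le> sqnorm x"
  by (simp add: sqnorm_def)

lemma sqnorm_eq_0_iff [simp]: "sqnorm x = 0 \<longleftrightarrow> x = 0"
  using ip_self_eq_0D[of x] ip_scale_left[of 0 0 0] by (auto simp: sqnorm_def)

lemma sqnorm_0 [simp]: "sqnorm 0 = 0"
  by simp

lemma sqnorm_pos: "x \<noteq> 0 \<Longrightarrow> 0 < sqnorm x"
  using sqnorm_nonneg[of x] sqnorm_eq_0_iff[of x] by linarith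

lemma cj_0 [simp]: "cj 0 = 0"
  using cj_of_real[of 0] by simp

lemma cj_minus: "cj (- a) = - cj a"
  using cj_add[of a "- a"] by (simp add: add_eq_0_iff)

lemma ip_0_left [simp]: "ip 0 x = 0"
  using ip_scale_left[of 0 0 x] by simp

lemma ip_0_right [simp]: "ip x 0 = 0"
  using ip_commute[of x 0] by simp

lemma ip_minus_left: "ip (- x) y = - ip x y"
  using ip_add_left[of x "- x" y] by (simp add: add_eq_0_iff)

lemma ip_diff_left: "ip (x - y) z = ip x z - ip y z"
  using ip_add_left[of x "- y" z] by (simp add: ip_minus_left)

lemma ip_add_right: "ip z (x + y) = ip z x + ip z y"
  by (metis ip_commute ip_add_left cj_add)

lemma ip_scale_right: "ip y (scl c x) = cj c * ip y x"
  by (metis ip_commute ip_scale_left cj_mult)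

lemma ip_minus_right: "ip y (- x) = - ip y x"
  by (metis ip_commute ip_minus_left cj_minus)

lemma ip_diff_right: "ip z (x - y) = ip z x - ip z y"
  using ip_add_right[of z x "- y"] by (simp add: ip_minus_right)

lemmas ip_simps = ip_add_left ip_add_right ip_diff_left ip_diff_right ip_minus_left ip_minus_right
  ip_scale_left ip_scale_right

lemma ip_eq_0_commute: "ip x y = 0 \<longleftrightarrow> ip y x = 0"
  using ip_commute[of x y] ip_commute[of y x] by auto

lemma sqnorm_scale: "sqnorm (scl c x) = (norm c)\<^sup>2 * sqnorm x"
  proof (rule sqnorm_eqI)
  have "ip (scl c x) (scl c x) = (c * cj c) * of_real (sqnorm x)"
    by (simp only: ip_scale_left ip_scale_right ip_self[of x] mult.assoc mult.left_commute)
  then show "ip (scl c x) (scl c x) = of_real ((norm c)\<^sup>2 * sqnorm x)"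
    by (simp add: mult_cj)
qed simp

lemma sqnorm_scale_of_real [simp]: "sqnorm (scl (of_real r) x) = r\<^sup>2 * sqnorm x"
  by (simp add: sqnorm_scale)

end

section \<open>Slices of a saturated cone\<close>

text \<open>Saturation as the geometry uses it, free of \<open>d\<close>: in \<open>proj\<close>,
  \<open>v\<close> is the projection of \<open>y\<close> to the span of \<open>x\<close> and
  \<open>v\<close>. The axiom \<open>ex_orthogonal\<close> stands for dimension at least 3.\<close>

locale saturated_cone = hermitian_space scl cj ip
  for scl :: "'k::real_normed_field \<Rightarrow> 'v::ab_group_add \<Rightarrow> 'v" and cj ip +
  fixes K :: "'v set"
  assumes ex_orthogonal: "\<exists>w. w \<noteq> 0 \<and> ip w u = 0 \<and> ip w v = 0"
    and nonzero: "x \<in> K \<Longrightarrow> x \<noteq> 0"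
    and scale: "x \<in> K \<Longrightarrow> c \<noteq> 0 \<Longrightarrow> scl c x \<in> K"
    and proj: "x \<in> K \<Longrightarrow> y \<in> K \<Longrightarrow> v \<noteq> 0 \<Longrightarrow> ip (y - v) x = 0 \<Longrightarrow> ip (y - v) v = 0 \<Longrightarrow> v \<in> K"
begin

lemma ex_orthogonal_sqnorm:
  assumes "0 \<le> r"
  obtains w where "ip w u = 0" "ip w v = 0" "sqnorm w = r"
proof -
  obtain w where w: "w \<noteq> 0" "ip w u = 0" "ip w v = 0"
    using ex_orthogonal by blast
  show ?thesis
  proof (rule that)
    let ?w = "scl (of_real (sqrt (r / sqnorm w))) w"
    show "ip ?w u = 0" "ip ?w v = 0"
      using w by (simp_all add: ip_simps)
    show "sqnorm ?w = r"
      using w(1) assms by simp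
  qed
qed

text \<open>The difference \<open>z - z'\<close> is orthogonal to \<open>x\<close> and
  \<open>z'\<close>, so projecting in the slice is projecting in the cone.\<close>

lemma slice_proj:
  assumes "x \<in> K" "x + z \<in> K" "ip z x = 0" "ip z' x = 0" "ip (z - z') z' = 0"
  shows "x + z' \<in> K"
proof (rule proj)
  show "x \<in> K" "x + z \<in> K" by fact+
  show "ip (x + z - (x + z')) x = 0" "ip (x + z - (x + z')) (x + z') = 0"
    using assms(3-5) ip_eq_0_commute[of x z] ip_eq_0_commute[of x z']
    by (simp_all add: ip_simps)
  have "ip (x + z') x \<noteq> 0"
    using assms(4) nonzero[OF assms(1)] ip_self_eq_0D[of x] by (auto simp: ip_simps)
  then show "x + z' \<noteq> 0" by auto
qed

lemma slice_shrink:
  assumes "x \<in> K" "x + e \<in> K" "ip e x = 0" "0 \<le> c" "c \<le> 1"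
  shows "x + scl (of_real c) e \<in> K"
proof -
  obtain f where f: "ip f x = 0" "ip f e = 0" "sqnorm f = sqnorm e"
    using ex_orthogonal_sqnorm[of "sqnorm e" x e] by auto
  have f': "ip e f = 0"
    using f(2) ip_eq_0_commute by blast
  \<comment> \<open>This \<open>s\<close> puts \<open>scl b e + scl s f\<close> on the sphere with
    diameter from 0 to \<open>e\<close>, which makes it the projection of \<open>e\<close> to its
    own line.\<close>
  define s where "s = (of_real (sqrt (c * (1 - c))) :: 'k)"
  define b where "b = (of_real c :: 'k)"
  have "sqrt (c * (1 - c)) * sqrt (c * (1 - c)) = c * (1 - c)"
    using assms(4,5) by simp
  then have s: "s * s = b * (1 - b)"
    unfolding s_def b_def by (metis of_real_mult of_real_diff of_real_1)
  have cj: "cj s = s" "cj b = b" by (simp_all add: s_def b_def)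
  have *: "x + (scl b e + scl s f) \<in> K"
  proof (rule slice_proj)
    show "x \<in> K" "x + e \<in> K" "ip e x = 0" by fact+
    show "ip (scl b e + scl s f) x = 0"
      using assms(3) f by (simp add: ip_simps)
    have "ip (e - (scl b e + scl s f)) (scl b e + scl s f)
      = (b * (1 - b) - s * s) * of_real (sqnorm e)"
      using f f' by (simp add: ip_simps cj ip_self algebra_simps)
    then show "ip (e - (scl b e + scl s f)) (scl b e + scl s f) = 0"
      using s by simp
  qed
  \<comment> \<open>Project to a line at angle \<open>arccos (sqrt c)\<close> and back again.\<close>
  show ?thesis
    unfolding b_def[symmetric]
  proof (rule slice_proj[OF assms(1) *])
    show "ip (scl b e + scl s f) x = 0" "ip (scl b e) x = 0"
      "ip (scl b e + scl s f - scl b e) (scl b e) = 0"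
      using assms(3) f by (simp_all add: ip_simps)
  qed
qed

text \<open>Each step projects to a line turned by a further \<open>t\<close> in the real plane of
  \<open>e\<close> and \<open>f\<close> and so costs a factor \<open>cos t\<close>.\<close>

lemma slice_rotate:
  assumes "x \<in> K" "x + e \<in> K" "ip e x = 0" "ip f x = 0" "ip f e = 0" "sqnorm f = sqnorm e"
  shows "x + scl (of_real (cos t ^ j))
    (scl (of_real (cos (j * t))) e + scl (of_real (sin (j * t))) f) \<in> K"
proof (induction j)
  case 0
  then show ?case using assms(2) by simp
next
  case (Suc j)
  define v where "v s = scl (of_real (cos s)) e + scl (of_real (sin s)) f" for s
  have f': "ip e f = 0"
    using assms(5) ip_eq_0_commute by blast
  have ipv: "ip (v a) (v b) = of_real (cos (a - b)) * of_real (sqnorm e)" for a b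
    using assms(5,6) f' by (simp add: v_def ip_simps ip_self cos_diff algebra_simps)
  have vx: "ip (v a) x = 0" for a
    using assms(3,4) by (simp add: v_def ip_simps)
  have orth: "ip (scl (of_real p) (v a) - scl (of_real (p * cos (a - b))) (v b))
    (scl (of_real (p * cos (a - b))) (v b)) = 0" for p a b
    by (simp add: ip_diff_left ip_scale_left ip_scale_right ipv)
  have "j * t - Suc j * t = - t" by (simp add: algebra_simps)
  then have "cos (j * t - Suc j * t) = cos t" by simp
  note orth' = orth[of "cos t ^ j" "j * t" "Suc j * t", unfolded this, folded power_Suc2]
  have "x + scl (of_real (cos t ^ Suc j)) (v (Suc j * t)) \<in> K"
  proof (rule slice_proj[OF assms(1) _ _ _ orth'])
    show "x + scl (of_real (cos t ^ j)) (v (j * t)) \<in> K"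
      using Suc.IH unfolding v_def .
  qed (simp_all only: ip_scale_left vx mult_zero_right)
  then show ?case unfolding v_def .
qed

text \<open>As \<open>ip f e\<close> is real, \<open>f\<close> lies in a real plane spanned by
  \<open>e\<close> and a vector orthogonal to it, where \<open>slice_rotate\<close> applies. The
  bound \<open>c < 1\<close> leaves room for the length lost on the way.\<close>

lemma slice_move_real:
  assumes "x \<in> K" "x + e \<in> K" "ip e x = 0" "ip f x = 0" "sqnorm f = sqnorm e"
    "ip f e = of_real r" "0 \<le> r" "0 \<le> c" "c < 1"
  shows "x + scl (of_real c) f \<in> K"
proof (cases "e = 0 \<or> f = e")
  case True
  then have "f = e" using assms(5) sqnorm_eq_0_iff[of f] by auto
  then show ?thesis
    using slice_shrink[of x e c] assms by simp
next
  case False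
  \<comment> \<open>The cosine of the angle between \<open>e\<close> and \<open>f\<close>, which
    have equal length.\<close>
  define a where "a = r / sqnorm e"
  have e: "sqnorm e > 0" using False sqnorm_pos by blast
  have r: "r = a * sqnorm e" and a0: "0 \<le> a" using e assms(7) False by (simp_all add: a_def)
  have ef: "ip e f = of_real r"
    using ip_commute[of e f] assms(6) by simp
  define h where "h = f - scl (of_real a) e"
  have he: "ip h e = 0"
    by (simp add: h_def ip_simps assms(6) ip_self r)
  have hx: "ip h x = 0"
    using assms(3,4) by (simp add: h_def ip_simps)
  have iph: "ip h h = of_real ((1 - a\<^sup>2) * sqnorm e)"
    using assms(5,6) ef by (simp add: h_def ip_simps ip_self[of e] ip_self[of f] r power2_eq_square algebra_simps)
  have h0: "h \<noteq> 0"
  proof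
    assume "h = 0"
    then have "f = scl (of_real a) e" by (simp add: h_def)
    with assms(5) e False have "a\<^sup>2 = 1" by simp
    with a0 have "a = 1" by (simp add: power2_eq_1_iff)
    with \<open>f = scl (of_real a) e\<close> False show False by simp
  qed
  have "of_real ((1 - a\<^sup>2) * sqnorm e) = (of_real (sqnorm h) :: 'k)"
    using iph by (simp add: ip_self)
  then have qh: "sqnorm h = (1 - a\<^sup>2) * sqnorm e"
    using of_real_eq_iff by metis
  then have "(1 - a\<^sup>2) * sqnorm e > 0"
    using sqnorm_pos[OF h0] by simp
  then have a1: "a\<^sup>2 < 1" using e by (simp add: zero_less_mult_iff)
  define t where "t = arccos a"
  have "\<bar>a\<bar> \<le> 1" using a1 abs_square_less_1[of a] by linarith
  then have ct: "cos t = a" and st: "sin t = sqrt (1 - a\<^sup>2)"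
    by (simp_all add: t_def sin_arccos)
  define g where "g = scl (of_real (1 / sin t)) h"
  have st0: "sin t > 0" using st a1 by simp
  have g: "ip g x = 0" "ip g e = 0" "f = scl (of_real (cos t)) e + scl (of_real (sin t)) g"
    using he hx st0 by (simp_all add: g_def ip_simps ct h_def)
  have gq: "sqnorm g = sqnorm e"
    using a1 unfolding g_def sqnorm_scale_of_real qh st by (simp add: power_divide)
  \<comment> \<open>Enough steps keep the total factor above \<open>c\<close>;
    \<open>slice_shrink\<close> takes up the difference.\<close>
  obtain k where k: "c < cos (t / real k) ^ k" "k > 0"
  proof -
    have "eventually (\<lambda>k. c < cos (t / real k) ^ k) sequentially"
      using order_tendstoD(1)[OF cos_div_power_tendsto] assms(9) by blast
    then have "eventually (\<lambda>k. c < cos (t / real k) ^ k \<and> k > 0) sequentially"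
      using eventually_gt_at_top[of 0] by eventually_elim simp
    then show ?thesis using that eventually_happens'[OF sequentially_bot] by blast
  qed
  let ?C = "cos (t / real k) ^ k"
  have "x + scl (of_real ?C) f \<in> K"
    using slice_rotate[OF assms(1-3) g(1,2) gq, of "t / k" k] k(2) g(3) by simp
  from slice_shrink[OF assms(1) this, of "c / ?C"]
  have "x + scl (of_real (c / ?C)) (scl (of_real ?C) f) \<in> K"
    using k(1) assms(4,8) by (simp add: ip_simps)
  moreover have "?C \<noteq> 0" using k(1) assms(8) by linarith
  then have "c / ?C * ?C = c" by (metis nonzero_eq_divide_eq)
  ultimately show ?thesis
    by (simp only: scale_scale flip: of_real_mult)
qed

lemma ex_phase: "\<exists>w::'k. norm w = 1 \<and> w * a = of_real (norm a)"
proof (cases "a = 0")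
  case True
  then show ?thesis by (auto intro: exI[of _ 1])
next
  case False
  then show ?thesis by (intro exI[of _ "of_real (norm a) / a"]) (simp add: norm_divide)
qed

lemma slice_ball:
  assumes "x \<in> K" "x + z \<in> K" "ip z x = 0" "ip u x = 0" "sqnorm u < sqnorm z"
  shows "x + u \<in> K"
proof (cases "u = 0")
  case True
  then show ?thesis using assms(1) by simp
next
  case False
  have u: "sqnorm u > 0" using False sqnorm_pos by blast
  obtain f0 where f0: "ip f0 x = 0" "ip f0 u = 0" "sqnorm f0 = sqnorm z"
    using ex_orthogonal_sqnorm[of "sqnorm z" x u] by auto
  \<comment> \<open>The phase \<open>w\<close> makes \<open>ip f z\<close> real and nonnegative, as
    \<open>slice_move_real\<close> requires.\<close>
  obtain w where w: "norm w = 1" "w * ip f0 z = of_real (norm (ip f0 z))"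
    using ex_phase by blast
  define f where "f = scl w f0"
  have f: "ip f x = 0" "ip f u = 0" "sqnorm f = sqnorm z" "ip f z = of_real (norm (ip f0 z))"
    using f0 w by (simp_all add: f_def ip_simps sqnorm_scale)
  have f': "ip u f = 0" using f(2) ip_eq_0_commute by blast
  \<comment> \<open>The ratio of the lengths of \<open>u\<close> and \<open>z\<close>; each of the
    two moves scales by its square root.\<close>
  define k where "k = sqrt (sqnorm u / sqnorm z)"
  have k: "0 < k" "k < 1" "k\<^sup>2 = sqnorm u / sqnorm z"
    using u assms(5) by (simp_all add: k_def)
  \<comment> \<open>The detour through \<open>f\<close>, orthogonal to \<open>u\<close>, absorbs the phase of \<open>ip z u\<close>.\<close>
  have 1: "x + scl (of_real (sqrt k)) f \<in> K"
    by (rule slice_move_real[OF assms(1-3) f(1,3,4)]) (use k in auto)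
  have "x + scl (of_real (sqrt k)) (scl (of_real (1 / sqrt k)) u) \<in> K"
  proof (rule slice_move_real[OF assms(1) 1, where r = 0])
    show "sqnorm (scl (of_real (1 / sqrt k)) u) = sqnorm (scl (of_real (sqrt k)) f)"
      using k u assms(5) f(3) less_imp_neq[OF less_trans[OF u assms(5)]]
      by (simp add: sqnorm_scale norm_divide field_simps power2_eq_square flip: mult.assoc)
  qed (use k f f' assms(4) in \<open>auto simp: ip_simps\<close>)
  then show ?thesis using k by (simp flip: of_real_mult)
qed

section \<open>Growing balls of lines about a point\<close>

text \<open>With \<open>x + u\<close> representing a line, this is the open ball of lines whose
  angle with \<open>x\<close> has tangent less than the absolute value of \<open>t\<close>.\<close>

definition full_ball :: "'v \<Rightarrow> real \<Rightarrow> bool" where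
  "full_ball x t \<longleftrightarrow> (\<forall>u. ip u x = 0 \<longrightarrow> sqnorm u < t\<^sup>2 * sqnorm x \<longrightarrow> x + u \<in> K)"

text \<open>The addition formula of the tangent: \<open>s\<close> and \<open>r\<close> are the tangents of the angles from \<open>x\<close> to \<open>y\<close>
  and from \<open>y\<close> on to a point of the ball about \<open>y\<close>, whose radius is the angle from \<open>y\<close> back to \<open>x\<close>.\<close>

lemma full_ball_add:
  assumes "x \<in> K" "full_ball x t" "0 < s" "s < t" "0 < r" "r < s" "r * s < 1"
  shows "full_ball x ((s + r) / (1 - r * s))"
proof -
  define N where "N = sqnorm x"
  have N: "N > 0" using nonzero[OF assms(1)] sqnorm_pos by (simp add: N_def)
  obtain e where e: "ip e x = 0" "sqnorm e = N"
    using ex_orthogonal_sqnorm[of N x x] N by auto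
  have e': "ip x e = 0" using e(1) ip_eq_0_commute by blast
  have ipN: "ip e e = of_real N" "ip x x = of_real N"
    using e(2) by (simp_all add: ip_self N_def)
  have st: "s\<^sup>2 < t\<^sup>2" "r\<^sup>2 < s\<^sup>2"
    using assms(3-6) by (simp_all add: power_strict_mono)
  define y where "y = x + scl (of_real s) e"
  \<comment> \<open>This is \<open>y\<close> turned by a right angle in the plane of
    \<open>x\<close> and \<open>e\<close>, so coefficients of \<open>p\<close> are tangents of
    angles seen from \<open>y\<close>.\<close>
  define p where "p = e - scl (of_real s) x"
  have yK: "y \<in> K"
    using assms(2) e N st(1) by (auto simp: y_def full_ball_def ip_simps N_def[symmetric])
  have py: "ip p y = 0"
    by (simp add: p_def y_def ip_simps e e' ipN)
  have qp: "sqnorm p = (1 + s\<^sup>2) * N"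
    by (rule sqnorm_eqI)
      (use N in \<open>simp_all add: p_def ip_simps e e' ipN power2_eq_square algebra_simps\<close>)
  have s1: "1 + s\<^sup>2 > 0" by (simp add: add_pos_nonneg)
  \<comment> \<open>Seen from \<open>y\<close>, the line of \<open>x\<close> lies at tangent
    \<open>- s\<close>; the ball about \<open>y\<close> thus reaches tangent \<open>r\<close> on the
    other side.\<close>
  have "y + scl (of_real (- s)) p = scl (of_real (1 + s\<^sup>2)) x"
    by (simp add: y_def p_def power2_eq_square algebra_simps)
  moreover have "of_real (1 + s\<^sup>2) \<noteq> (0::'k)"
    using s1 unfolding of_real_eq_0_iff by simp
  ultimately have "y + scl (of_real (- s)) p \<in> K"
    using scale[OF assms(1)] by simp
  then have "y + scl (of_real r) p \<in> K"
  proof (rule slice_ball[OF yK])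
    show "sqnorm (scl (of_real r) p) < sqnorm (scl (of_real (- s)) p)"
      unfolding sqnorm_scale_of_real using st(2) qp N s1 by simp
  qed (simp_all add: ip_simps py)
  \<comment> \<open>The sum of the angles stays below a right angle, so the component along
    \<open>x\<close> does not vanish.\<close>
  moreover have "1 - of_real r * of_real s \<noteq> (0 :: 'k)"
    using assms(7) by (metis of_real_mult of_real_eq_1_iff eq_iff_diff_eq_0 less_irrefl)
  ultimately have "scl (1 / (1 - of_real r * of_real s)) (y + scl (of_real r) p) \<in> K"
    by (intro scale) auto
  moreover have "y + scl (of_real r) p = scl (1 - of_real r * of_real s) x + scl (of_real s + of_real r) e"
    by (simp add: y_def p_def algebra_simps)
  ultimately have K: "x + scl (of_real ((s + r) / (1 - r * s))) e \<in> K"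
    using \<open>1 - of_real r * of_real s \<noteq> (0 :: 'k)\<close> by (simp add: scale_right_distrib)
  show ?thesis
    unfolding full_ball_def
  proof (intro allI impI)
    fix u assume "ip u x = 0" "sqnorm u < ((s + r) / (1 - r * s))\<^sup>2 * sqnorm x"
    then show "x + u \<in> K"
      by (intro slice_ball[OF assms(1) K])
        (simp_all add: ip_simps e N_def[symmetric] del: of_real_divide of_real_add of_real_diff of_real_mult)
  qed
qed

lemma full_ball_mono: "full_ball x t \<Longrightarrow> 0 \<le> s \<Longrightarrow> s \<le> t \<Longrightarrow> full_ball x s"
  unfolding full_ball_def
  by (meson less_le_trans mult_right_mono power_mono sqnorm_nonneg)

text \<open>Geometric growth brings the tangent above 1, an angle of more than 45 degrees; one
  further addition then reaches any angle below a right one.\<close>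

lemma full_ball_all:
  assumes "x \<in> K" "full_ball x t0" "0 < t0"
  shows "full_ball x t"
proof -
  \<comment> \<open>The tangents \<open>3 / 4 * t\<close> and \<open>t / 2\<close> have sum
    \<open>5 / 4 * t\<close>, and the denominator lies between 0 and 1.\<close>
  have step: "full_ball x (5 / 4 * t)" if "full_ball x t" "0 < t" "t \<le> 1" for t
  proof -
    have *: "t * t \<le> 1" using that mult_le_one[of t t] by simp
    have "full_ball x ((3 / 4 * t + t / 2) / (1 - t / 2 * (3 / 4 * t)))"
      by (rule full_ball_add[OF assms(1) that(1)]) (use that * in auto)
    then show ?thesis
      by (rule full_ball_mono) (use that * in \<open>auto simp: field_simps\<close>)
  qed
  have grow: "(\<exists>t>1. full_ball x t) \<or> full_ball x ((5 / 4) ^ k * t0)" for k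
  proof (induction k)
    case (Suc k)
    have pos: "(5 / 4) ^ k * t0 > 0" using assms(3) by simp
    show ?case
    proof (cases "(5 / 4) ^ k * t0 \<le> 1")
      case True
      then show ?thesis using Suc step[of "(5 / 4) ^ k * t0"] pos by (auto simp: mult.assoc)
    next
      case False
      then show ?thesis using Suc by (auto intro: exI[of _ "(5 / 4) ^ k * t0"])
    qed
  qed (use assms(2) in simp)
  obtain k where "1 / t0 < (5 / 4) ^ k"
    using real_arch_pow[of "5 / 4"] by auto
  then have "1 < (5 / 4) ^ k * t0" using assms(3) by (simp add: field_simps)
  then obtain t1 where t1: "1 < t1" "full_ball x t1"
    using grow[of k] by blast
  define M where "M = \<bar>t\<bar> + 2"
  \<comment> \<open>The solution of \<open>(1 + r) / (1 - r) = M\<close>, which lies between 0 and 1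
    since \<open>M\<close> exceeds 1.\<close>
  define r where "r = (M - 1) / (M + 1)"
  have M: "M \<ge> 2" by (simp add: M_def)
  then have r: "0 < r" "r < 1" "(1 + r) / (1 - r * 1) = M"
    by (simp_all add: r_def field_simps)
  then have "full_ball x M"
    using full_ball_add[OF assms(1) t1(2), of 1 r] t1(1) by simp
  then have "full_ball x \<bar>t\<bar>"
    by (rule full_ball_mono) (simp_all add: M_def)
  then show ?thesis by (simp add: full_ball_def)
qed

section \<open>From two lines to all lines\<close>

lemma scale_imp_mem: "c \<noteq> 0 \<Longrightarrow> scl c v \<in> K \<Longrightarrow> v \<in> K"
  using scale[of "scl c v" "1 / c"] by simp

lemma orthogonal_decomposition:
  assumes "x \<noteq> 0"
  obtains c u where "v = scl c x + u" "ip u x = 0"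
proof -
  let ?c = "ip v x / ip x x"
  have "ip x x \<noteq> 0" using assms ip_self_eq_0D by blast
  then have "ip (v - scl ?c x) x = 0" by (simp add: ip_simps)
  then show ?thesis using that[of ?c "v - scl ?c x"] by simp
qed

text \<open>Up to scaling, \<open>y\<close> and \<open>v\<close> both have the form
  \<open>x + u\<close> with \<open>u\<close> orthogonal to \<open>x\<close>. The nonzero
  \<open>u\<close> of \<open>y\<close> yields a ball of positive radius, which
  \<open>full_ball_all\<close> enlarges until it contains that of \<open>v\<close>.\<close>

lemma non_orthogonal_mem:
  assumes "x \<in> K" "y \<in> K" "ip y x \<noteq> 0" "\<And>c. y \<noteq> scl c x" "ip v x \<noteq> 0"
  shows "v \<in> K"
proof -
  have x0: "x \<noteq> 0" using assms(1) nonzero by blast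
  have normal: "\<exists>c u. c \<noteq> 0 \<and> w = scl c (x + u) \<and> ip u x = 0" if w: "ip w x \<noteq> 0" for w
  proof -
    obtain c u where cu: "w = scl c x + u" "ip u x = 0"
      using orthogonal_decomposition[OF x0] .
    then have "c \<noteq> 0" using w by (auto simp: ip_simps)
    then show ?thesis
      using cu by (intro exI[of _ c] exI[of _ "scl (1 / c) u"]) (simp add: scale_right_distrib ip_simps)
  qed
  obtain c z where z: "c \<noteq> 0" "y = scl c (x + z)" "ip z x = 0"
    using normal[OF assms(3)] by blast
  have zK: "x + z \<in> K" using scale_imp_mem z assms(2) by blast
  have "z \<noteq> 0" using z(2) assms(4)[of c] by auto
  then have ratio: "sqnorm z / sqnorm x > 0"
    using sqnorm_pos x0 by simp
  have "full_ball x (sqrt (sqnorm z / sqnorm x))"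
    unfolding full_ball_def using slice_ball[OF assms(1) zK z(3)] ratio x0 by simp
  then have ball: "full_ball x t" for t
    using full_ball_all[OF assms(1)] ratio real_sqrt_gt_zero by blast
  obtain b u where u: "b \<noteq> 0" "v = scl b (x + u)" "ip u x = 0"
    using normal[OF assms(5)] by blast
  have "sqnorm u < (sqrt (sqnorm u / sqnorm x + 1))\<^sup>2 * sqnorm x"
    using sqnorm_pos[OF x0] x0 by (simp add: field_simps)
  then have "x + u \<in> K"
    using ball u(3) unfolding full_ball_def by blast
  then show ?thesis using scale u by blast
qed

text \<open>For orthogonal \<open>x\<close> and \<open>y\<close>, take \<open>w\<close> orthogonal
  to both and as long as \<open>y\<close>; half of \<open>y + w\<close> is the projection of
  \<open>y\<close> to the plane of \<open>x\<close> and \<open>y + w\<close>, at 45 degrees to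
  \<open>y\<close>.\<close>

lemma ex_non_orthogonal:
  assumes "x \<in> K" "y \<in> K" "\<And>c. y \<noteq> scl c x"
  obtains x' y' where "x' \<in> K" "y' \<in> K" "ip y' x' \<noteq> 0" "\<And>c. y' \<noteq> scl c x'"
proof (cases "ip y x = 0")
  case True
  have y0: "y \<noteq> 0" using nonzero assms(2) by blast
  obtain w where w: "ip w x = 0" "ip w y = 0" "sqnorm w = sqnorm y"
    using ex_orthogonal_sqnorm[of "sqnorm y" x y] by auto
  have w': "ip y w = 0" using w(2) ip_eq_0_commute by blast
  have w0: "w \<noteq> 0" using w(3) y0 sqnorm_eq_0_iff by metis
  define v where "v = y + w"
  have vy: "ip v y \<noteq> 0"
    using ip_self_eq_0D[of y] y0 by (auto simp: v_def ip_simps w)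
  have "scl (1 / 2) v \<in> K"
  proof (rule proj[OF assms(1,2)])
    show "scl (1 / 2) v \<noteq> 0" using vy by auto
    show "ip (y - scl (1 / 2) v) x = 0" by (simp add: v_def ip_simps w True)
    have "cj (1 / 2) = 1 / 2" using cj_of_real[of "1 / 2"] by simp
    then show "ip (y - scl (1 / 2) v) (scl (1 / 2) v) = 0"
      using w w' by (simp add: v_def ip_simps ip_self field_simps)
  qed
  then have "v \<in> K" by (rule scale_imp_mem[rotated]) simp
  moreover have "v \<noteq> scl c y" for c
  proof
    assume "v = scl c y"
    then have "ip v w = 0" by (simp add: ip_simps w')
    then show False using ip_self_eq_0D[of w] w0 by (simp add: v_def ip_simps w')
  qed
  ultimately show ?thesis using that[of y v] assms(2) vy by blast
next
  case False
  then show ?thesis using that assms by blast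
qed

text \<open>A line orthogonal to \<open>a\<close> is reached in two moves: \<open>a + v\<close> is
  not orthogonal to \<open>a\<close>, and \<open>v\<close> is not orthogonal to
  \<open>a + v\<close>.\<close>

lemma all_mem:
  assumes "x \<in> K" "y \<in> K" "\<And>c. y \<noteq> scl c x" "v \<noteq> 0"
  shows "v \<in> K"
proof -
  obtain a b where ab: "a \<in> K" "b \<in> K" "ip b a \<noteq> 0" "\<And>c. b \<noteq> scl c a"
    using ex_non_orthogonal[OF assms(1-3)] by blast
  note mem = non_orthogonal_mem[OF ab]
  show ?thesis
  proof (cases "ip v a = 0")
    case True
    have av: "ip a v = 0" using True ip_eq_0_commute by blast
    have a0: "ip a a \<noteq> 0" "ip v v \<noteq> 0"
      using nonzero[OF ab(1)] ip_self_eq_0D assms(4) by blast+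
    have "a + v \<in> K" by (rule mem) (use True a0 in \<open>simp add: ip_simps\<close>)
    then show ?thesis
    proof (rule non_orthogonal_mem[OF _ ab(1)])
      show "a \<noteq> scl c (a + v)" for c
      proof
        assume *: "a = scl c (a + v)"
        then have "ip a v = ip (scl c (a + v)) v" by simp
        then have "c = 0" using a0 av by (simp add: ip_simps)
        with * a0 show False by simp
      qed
    qed (use a0 True av in \<open>simp_all add: ip_simps\<close>)
  qed (rule mem)
qed

end

section \<open>Subspaces and projections in finite dimension\<close>

locale finite_hermitian_space = finite_dimensional_vector_space scl Basis + hermitian_space scl cj ip
  for scl :: "'k::real_normed_field \<Rightarrow> 'v::ab_group_add \<Rightarrow> 'v" and Basis cj ip
begin

lemma dim_orthogonal:
  assumes "subspace W"
  shows "dim W \<le> dim {w \<in> W. ip w p = 0} + 1"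
proof (cases "\<forall>w\<in>W. ip w p = 0")
  case True
  then have "{w \<in> W. ip w p = 0} = W" by auto
  then show ?thesis by simp
next
  case False
  then obtain a where a: "a \<in> W" "ip a p \<noteq> 0" by blast
  let ?W = "{w \<in> W. ip w p = 0}"
  have "w \<in> span (insert a ?W)" if "w \<in> W" for w
  proof -
    let ?c = "ip w p / ip a p"
    have "w - scl ?c a \<in> W"
      using that a(1) assms by (intro subspace_diff subspace_scale)
    moreover have "ip (w - scl ?c a) p = 0" using a(2) by (simp add: ip_simps)
    ultimately have "w - scl ?c a \<in> ?W" by blast
    then have "w - scl ?c a \<in> span ?W" by (rule span_base)
    then show ?thesis by (subst span_breakdown_eq) (rule exI)
  qed
  then have "W \<subseteq> span (insert a ?W)" by (rule subsetI)
  then have "dim W \<le> dim (insert a ?W)" by (rule dim_mono)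
  also have "\<dots> \<le> dim ?W + 1" by (simp add: dim_insert)
  finally show ?thesis .
qed

lemma subspace_orthogonal: "subspace W \<Longrightarrow> subspace {w \<in> W. ip w p = 0}"
  by (auto simp: subspace_def ip_simps)

lemma ex_orthogonal_pair:
  assumes "3 \<le> dim (UNIV :: 'v set)"
  shows "\<exists>w. w \<noteq> 0 \<and> ip w u = 0 \<and> ip w v = 0"
proof (rule ccontr)
  let ?A = "{w \<in> UNIV. ip w u = 0}"
  let ?B = "{w \<in> ?A. ip w v = 0}"
  assume "\<not> ?thesis"
  then have "dim ?B = 0" by auto
  moreover have "dim (UNIV :: 'v set) \<le> dim ?A + 1" "dim ?A \<le> dim ?B + 1"
    using dim_orthogonal[OF subspace_UNIV, of u]
      dim_orthogonal[OF subspace_orthogonal[OF subspace_UNIV], of u v] .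
  ultimately show False using assms by linarith
qed

lemma subspace_between:
  assumes "A \<subseteq> W" "subspace W" "dim A \<le> d" "d \<le> dim W"
  obtains U where "subspace U" "A \<subseteq> U" "U \<subseteq> W" "dim U = d"
proof -
  obtain B where B: "B \<subseteq> A" "independent B" "A \<subseteq> span B" "card B = dim A"
    using basis_exists by blast
  obtain C where C: "B \<subseteq> C" "C \<subseteq> W" "independent C" "W \<subseteq> span C"
    using maximal_independent_subset_extend[of B W] B assms(1) by blast
  have "card C = dim W" using C basis_card_eq_dim by blast
  then obtain D where D: "B \<subseteq> D" "D \<subseteq> C" "card D = d"
    using exists_subset_between[of B d C] B C assms finiteI_independent by metis
  show ?thesis
  proof (rule that)
    show "subspace (span D)" by (rule subspace_span)
    show "A \<subseteq> span D" using B(3) D(1) span_mono by blast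
    show "span D \<subseteq> W" using D C assms(2) by (intro span_minimal) auto
    show "dim (span D) = d"
      using dim_span_eq_card_independent[OF independent_mono[OF C(3) D(2)]] D(3) by simp
  qed
qed

text \<open>The difference of two candidates lies in \<open>U\<close> and is orthogonal to
  \<open>U\<close>, hence to itself.\<close>

lemma orth_proj_eqI:
  assumes "subspace U" "w \<in> U" "\<And>u. u \<in> U \<Longrightarrow> ip (v - w) u = 0"
  shows "orth_proj ip U v = w"
  unfolding orth_proj_def
proof (rule the_equality)
  show "w \<in> U \<and> (\<forall>u\<in>U. ip (v - w) u = 0)" using assms by blast
  fix w' assume w': "w' \<in> U \<and> (\<forall>u\<in>U. ip (v - w') u = 0)"
  then have "w' - w \<in> U" using assms subspace_diff by blast
  then have "ip (v - w) (w' - w) - ip (v - w') (w' - w) = 0"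
    using w' assms(3) by simp
  then have "ip (w' - w) (w' - w) = 0" by (simp add: ip_diff_left)
  then show "w' = w" using ip_self_eq_0D by fastforce
qed

section \<open>Saturated sets of lines\<close>

lemma projective_space_eq: "projective_space scl = {span {v} |v. v \<noteq> 0}"
proof (intro subset_antisym subsetI)
  fix L assume "L \<in> projective_space scl"
  then have L: "subspace L" "dim L = 1"
    by (auto simp: projective_space_def grassmannian_def)
  obtain B where B: "B \<subseteq> L" "independent B" "L \<subseteq> span B" "card B = dim L"
    using basis_exists by blast
  then obtain v where "B = {v}" using L(2) card_1_singletonE by metis
  with B L(1) show "L \<in> {span {v} |v. v \<noteq> 0}"
    using span_minimal[of B L] dependent_single[of v] by blast
next
  fix L assume "L \<in> {span {v} |v. v \<noteq> 0}"
  then show "L \<in> projective_space scl"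
    by (auto simp: projective_space_def grassmannian_def subspace_span)
qed

text \<open>Here \<open>d\<close> drops out. The orthogonal complement \<open>W\<close> of
  \<open>y - v\<close> contains \<open>x\<close> and \<open>v\<close> and has dimension at least
  \<open>d\<close>, so a \<open>d\<close>-dimensional \<open>U\<close> fits in between, and
  projection to \<open>U\<close> sends \<open>y\<close> to \<open>v\<close>.\<close>

lemma saturated_cone_of_saturated:
  assumes "1 < d" "d < dim (UNIV :: 'v set)" "tau_saturated scl ip 1 d S"
  shows "saturated_cone scl cj ip {v. v \<noteq> 0 \<and> span {v} \<in> S}"
proof unfold_locales
  show "\<exists>w. w \<noteq> 0 \<and> ip w u = 0 \<and> ip w v = 0" for u v
    using ex_orthogonal_pair assms(1,2) by simp
next
  fix x and c :: 'k assume "x \<in> {v. v \<noteq> 0 \<and> span {v} \<in> S}" "c \<noteq> 0"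
  then show "scl c x \<in> {v. v \<noteq> 0 \<and> span {v} \<in> S}"
    by (simp add: span_image_scale[of "{x}" "\<lambda>_. c", simplified])
next
  fix x y v
  assume x: "x \<in> {v. v \<noteq> 0 \<and> span {v} \<in> S}" and y: "y \<in> {v. v \<noteq> 0 \<and> span {v} \<in> S}"
    and v: "v \<noteq> 0" "ip (y - v) x = 0" "ip (y - v) v = 0"
  define W where "W = {w \<in> UNIV. ip w (y - v) = 0}"
  have W: "subspace W" "dim (UNIV :: 'v set) \<le> dim W + 1"
    unfolding W_def
    using subspace_orthogonal[OF subspace_UNIV] dim_orthogonal[OF subspace_UNIV] .
  have "{x, v} \<subseteq> W" using v ip_eq_0_commute[of "y - v"] by (auto simp: W_def)
  moreover have "dim {x, v} \<le> d" using dim_le_card'[of "{x, v}"] card_insert_le_m1[of 2 "{v}" x] assms(1) by simp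
  moreover have "d \<le> dim W" using W(2) assms(2) by linarith
  ultimately obtain U where U: "subspace U" "{x, v} \<subseteq> U" "U \<subseteq> W" "dim U = d"
    using subspace_between[OF _ W(1)] by blast
  have "ip (y - v) u = 0" if "u \<in> U" for u
  proof -
    have "ip u (y - v) = 0" using that U(3) unfolding W_def by blast
    then show ?thesis using ip_eq_0_commute by blast
  qed
  then have "orth_proj ip U (scl c y) = scl c v" for c
    using U by (intro orth_proj_eqI)
      (simp_all add: subspace_scale ip_scale_left flip: scale_right_diff_distrib)
  then have "orth_proj ip U ` span {y} = span {v}"
    by (auto simp: span_singleton image_image)
  moreover have "span {x} \<subseteq> U" using U by (intro span_minimal) auto
  ultimately have "tau scl ip d (span {x}) (span {y}) (span {v})"
    using U by (auto simp: tau_def grassmannian_def)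
  moreover have "span {v} \<in> grassmannian scl 1"
    using v(1) projective_space_eq by (auto simp: projective_space_def)
  ultimately show "v \<in> {v. v \<noteq> 0 \<and> span {v} \<in> S}"
    using x y v(1) assms(3) by (auto simp: tau_saturated_def)
qed simp

lemma singleton_saturated:
  assumes "L \<in> projective_space scl"
  shows "tau_saturated scl ip 1 d {L}"
proof -
  have "orth_proj ip U ` L = L" if "subspace U" "L \<subseteq> U" for U
  proof -
    have "orth_proj ip U v = v" if "v \<in> L" for v
      using \<open>subspace U\<close> \<open>L \<subseteq> U\<close> that by (intro orth_proj_eqI) auto
    then show ?thesis by force
  qed
  then show ?thesis
    using assms by (auto simp: tau_saturated_def tau_def grassmannian_def projective_space_def)
qed

text \<open>The empty set is vacuously saturated, hence the condition
  \<open>S \<noteq> {}\<close>.\<close>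

theorem saturated_subsets:
  assumes "1 < d" "d < dim (UNIV :: 'v set)"
  shows "{S. S \<noteq> {} \<and> tau_saturated scl ip 1 d S} =
    {{L} |L. L \<in> projective_space scl} \<union> {projective_space scl}"
proof (intro subset_antisym subsetI)
  fix S assume "S \<in> {S. S \<noteq> {} \<and> tau_saturated scl ip 1 d S}"
  then have S: "S \<noteq> {}" "tau_saturated scl ip 1 d S" by auto
  then have sub: "S \<subseteq> projective_space scl"
    by (simp add: tau_saturated_def projective_space_def)
  interpret K: saturated_cone scl cj ip "{v. v \<noteq> 0 \<and> span {v} \<in> S}"
    by (rule saturated_cone_of_saturated[OF assms S(2)])
  obtain L where L: "L \<in> S" using S(1) by blast
  show "S \<in> {{L} |L. L \<in> projective_space scl} \<union> {projective_space scl}"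
  proof (cases "S = {L}")
    case True
    then show ?thesis using sub by blast
  next
    case False
    then obtain L' where L': "L' \<in> S" "L' \<noteq> L" using L by blast
    have line: "\<exists>v. v \<noteq> 0 \<and> M = span {v}" if "M \<in> S" for M
      using subsetD[OF sub that] unfolding projective_space_eq by blast
    obtain x where x: "x \<noteq> 0" "L = span {x}" using line[OF L] by blast
    obtain y where y: "y \<noteq> 0" "L' = span {y}" using line[OF L'(1)] by blast
    note xy = x y
    have "y \<noteq> scl c x" for c
    proof
      assume "y = scl c x"
      moreover from this have "c \<noteq> 0" using xy by auto
      ultimately have "span {y} = span {x}"
        by (simp add: span_image_scale[of "{x}" "\<lambda>_. c", simplified])
      with xy L'(2) show False by simp
    qed
    then have "span {v} \<in> S" if "v \<noteq> 0" for v
      using K.all_mem[of x y v] that xy L L'(1) by simp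
    then have "projective_space scl \<subseteq> S"
      unfolding projective_space_eq by blast
    with sub have "S = projective_space scl" by (rule subset_antisym)
    then show ?thesis by (simp only: Un_iff singleton_iff simp_thms)
  qed
next
  fix S assume "S \<in> {{L} |L. L \<in> projective_space scl} \<union> {projective_space scl}"
  moreover have "tau_saturated scl ip 1 d (projective_space scl)"
    by (auto simp: tau_saturated_def projective_space_def)
  moreover have "projective_space scl \<noteq> {}"
  proof -
    obtain w :: 'v where "w \<noteq> 0"
    proof -
      have "3 \<le> dim (UNIV :: 'v set)" using assms by linarith
      from ex_orthogonal_pair[OF this, of 0 0] show ?thesis using that by blast
    qed
    then show ?thesis unfolding projective_space_eq by blast
  qed
  ultimately show "S \<in> {S. S \<noteq> {} \<and> tau_saturated scl ip 1 d S}"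
    using singleton_saturated by (elim UnE CollectE exE conjE singletonE) simp_all
qed

end

section \<open>Transfer to the real and complex cases\<close>

text \<open>An infinite set has \<open>card\<close> 0, so positive dimension forces a finite
  basis.\<close>

lemma (in vector_space) ex_finite_basis:
  assumes "0 < dim UNIV"
  obtains B where "finite_dimensional_vector_space scale B"
proof -
  obtain B where B: "independent B" "UNIV \<subseteq> span B" "card B = dim UNIV"
    by (rule basis_exists)
  have "finite_dimensional_vector_space scale B"
  proof unfold_locales
    show "finite B" using B(3) assms by (intro card_ge_0_finite) simp
    show "independent B" by (rule B(1))
    show "span B = UNIV" using B(2) by (rule top.extremum_uniqueI)
  qed
  then show ?thesis by (rule that)
qed

lemma (in hermitian_space) saturated_subsets_of_dim:
  assumes "1 < d" "d < dim (UNIV :: 'v set)"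
  shows "{S. S \<noteq> {} \<and> tau_saturated scl ip 1 d S} =
    {{L} |L. L \<in> projective_space scl} \<union> {projective_space scl}"
proof -
  obtain B where "finite_dimensional_vector_space scl B"
    using ex_finite_basis assms by auto
  then interpret finite_dimensional_vector_space scl B .
  interpret finite_hermitian_space scl B cj ip ..
  show ?thesis using saturated_subsets[OF assms] .
qed

lemma hermitian_space_real:
  "hermitian_space (scaleR :: real \<Rightarrow> 'a \<Rightarrow> 'a::real_inner) (\<lambda>a. a) inner"
  by unfold_locales
    (auto simp: inner_add_left inner_commute power2_eq_square algebra_simps)

lemma hermitian_space_complex:
  assumes "complex_inner_product_space scl ip"
  shows "hermitian_space scl cnj ip"
proof -
  interpret complex_inner_product_space scl ip by fact
  have zero: "ip 0 y = 0" for y using ip_scale_left[of 0 0 y] by simp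
  have real: "ip x x = of_real (Re (ip x x))" "0 \<le> Re (ip x x)" for x
    using ip_commute[of x x] ip_pos[of x] zero[of 0]
    by (cases "x = 0"; simp add: complex_eq_iff)+
  show ?thesis
  proof unfold_locales
    show "ip x x = of_real (norm (ip x x))" for x
      using real[of x] by (metis abs_of_nonneg norm_of_real)
    show "ip x x = 0 \<Longrightarrow> x = 0" for x
      using ip_pos[of x] by force
    show "a * cnj a = of_real ((norm a)\<^sup>2)" for a
      by (rule complex_norm_square[symmetric])
  qed (simp_all add: ip_add_left ip_scale_left flip: ip_commute)
qed

theorem theorem0p2:
  fixes n d :: nat
    and scl :: "complex \<Rightarrow> 'v \<Rightarrow> 'v::ab_group_add"
    and ip :: "'v \<Rightarrow> 'v \<Rightarrow> complex"
  assumes "1 < d" and "d < n" and "n \<ge> 3"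
  shows "(dim (UNIV :: 'a::real_inner set) = n \<longrightarrow>
      {S. S \<noteq> {} \<and> tau_saturated (scaleR :: real \<Rightarrow> 'a \<Rightarrow> 'a) inner 1 d S} =
        {{\<zeta>} | \<zeta>. \<zeta> \<in> projective_space (scaleR :: real \<Rightarrow> 'a \<Rightarrow> 'a)} \<union>
        {projective_space (scaleR :: real \<Rightarrow> 'a \<Rightarrow> 'a)}) \<and>
    (complex_inner_product_space scl ip \<and> vector_space.dim scl UNIV = n \<longrightarrow>
      {S. S \<noteq> {} \<and> tau_saturated scl ip 1 d S} =
        {{\<zeta>} | \<zeta>. \<zeta> \<in> projective_space scl} \<union> {projective_space scl})"
proof (intro conjI impI)
  assume "dim (UNIV :: 'a set) = n"
  then show "{S. S \<noteq> {} \<and> tau_saturated (scaleR :: real \<Rightarrow> 'a \<Rightarrow> 'a) inner 1 d S} =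
        {{\<zeta>} | \<zeta>. \<zeta> \<in> projective_space (scaleR :: real \<Rightarrow> 'a \<Rightarrow> 'a)} \<union>
        {projective_space (scaleR :: real \<Rightarrow> 'a \<Rightarrow> 'a)}"
    using assms(1,2)
    by (intro hermitian_space.saturated_subsets_of_dim[OF hermitian_space_real]) (simp_all add: dim_raw_def)
next
  assume "complex_inner_product_space scl ip \<and> vector_space.dim scl UNIV = n"
  then show "{S. S \<noteq> {} \<and> tau_saturated scl ip 1 d S} =
        {{\<zeta>} | \<zeta>. \<zeta> \<in> projective_space scl} \<union> {projective_space scl}"
    using assms(1,2)
    by (intro hermitian_space.saturated_subsets_of_dim[OF hermitian_space_complex]) auto
qed

end
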